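(* Let $d=1$. If $a>1/2$ and $f\in\mathfrak{L}^2_a(\mathbb{R})$, then $e^{itH}f(x)\to f(x)$ for almost every $x\in\mathbb{R}$ as $t\to0$.
   Context: $H=-\frac{d^2}{dx^2}+x^2$ on $\mathbb{R}$. Hermite functions $h_k(x)=(-1)^k(2^kk!\pi^{1/2})^{-1/2}H_k(x)e^{-x^2/2}$ ($H_k$ the Hermite polynomial of degree $k$) form an orthonormal basis of $L^2(\mathbb{R})$ with $Hh_k=(2k+1)h_k$. For $f=\sum_k a_kh_k\in L^2(\mathbb{R})$ and $t\in\mathbb{R}$, $e^{itH}f=\sum_k a_ke^{it(2k+1)}h_k$ (the solution of $i\partial_tu=Hu$, $u(\cdot,0)=f$, up to the sign convention for time). For $a>0$, $H^{-a/2}f=\sum_k(2k+1)^{-a/2}a_kh_k$ on $L^2$, and $\mathfrak{L}^2_a=H^{-a/2}(L^2(\mathbb{R}))$ with norm $\|f\|_{\mathfrak{L}^2_a}=\|g\|_2$ where $H^{-a/2}g=f$; equivalently $\|f\|_{\mathfrak{L}^2_a}^2=\sum_k(2k+1)^a|a_k|^2$. *)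

theory Defs
  imports "HOL-Analysis.Analysis" "HOL-Computational_Algebra.Polynomial"
begin

primrec hermite_poly :: "nat \<Rightarrow> real poly" where
  "hermite_poly 0 = 1"
| "hermite_poly (Suc k) = [:0, 2:] * hermite_poly k - pderiv (hermite_poly k)"

text \<open>The physicists' normalisation, as the Rodrigues formula shows.\<close>

lemma hermite_poly_rodrigues:
  "((deriv ^^ k) (\<lambda>x. exp (- x\<^sup>2))) x = (-1) ^ k * poly (hermite_poly k) x * exp (- (x::real)\<^sup>2)"
proof (induction k arbitrary: x)
  case 0
  then show ?case by simp
next
  case (Suc k)
  have eq: "(deriv ^^ k) (\<lambda>x. exp (- x\<^sup>2)) =
      (\<lambda>x::real. (-1) ^ k * poly (hermite_poly k) x * exp (- x\<^sup>2))"
    using Suc by (intro ext)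
  have "((\<lambda>x. (-1) ^ k * poly (hermite_poly k) x * exp (- x\<^sup>2)) has_real_derivative
      (-1) ^ Suc k * poly (hermite_poly (Suc k)) x * exp (- x\<^sup>2)) (at x)"
    by (auto intro!: derivative_eq_intros simp: algebra_simps)
  then show ?case by (simp only: funpow.simps o_apply eq DERIV_imp_deriv)
qed

definition hermite_fun :: "nat \<Rightarrow> real \<Rightarrow> real" where
  "hermite_fun k x =
     (-1) ^ k * poly (hermite_poly k) x * exp (- x\<^sup>2 / 2) / sqrt (2 ^ k * fact k * sqrt pi)"

lemma pderiv_hermite_poly:
  "pderiv (hermite_poly (Suc k)) = smult (2 * of_nat (Suc k)) (hermite_poly k)"
proof (induction k)
  case 0
  then show ?case by (simp add: pderiv_pCons pderiv_1)
next
  case (Suc k)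
  have "pderiv (hermite_poly (Suc (Suc k))) =
      smult 2 (hermite_poly (Suc k)) + [:0, 2:] * pderiv (hermite_poly (Suc k))
        - pderiv (pderiv (hermite_poly (Suc k)))"
    by (subst hermite_poly.simps(2)) (simp add: pderiv_diff pderiv_mult pderiv_pCons pderiv_smult del: hermite_poly.simps)
  also have "\<dots> = smult 2 (hermite_poly (Suc k))
      + smult (2 * of_nat (Suc k)) ([:0, 2:] * hermite_poly k - pderiv (hermite_poly k))"
    by (simp only: Suc pderiv_smult smult_diff_right mult_smult_right)
  also have "\<dots> = smult (2 * of_nat (Suc (Suc k))) (hermite_poly (Suc k))"
    by (simp only: hermite_poly.simps(2)[symmetric]) (simp add: smult_add_left[symmetric] del: hermite_poly.simps)
  finally show ?case .
qed

lemma hermite_fun_eigenfunction: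
  "- (deriv (deriv (hermite_fun k)) x) + x\<^sup>2 * hermite_fun k x = (2 * real k + 1) * hermite_fun k x"
proof -
  define p where "p = hermite_poly k"
  define c where "c = (-1) ^ k / sqrt (2 ^ k * fact k * sqrt pi)"
  have h: "hermite_fun k = (\<lambda>x. c * (poly p x * exp (- x\<^sup>2 / 2)))"
    by (auto simp: hermite_fun_def c_def p_def)
  have d1: "deriv (hermite_fun k) = (\<lambda>x. c * ((poly (pderiv p) x - x * poly p x) * exp (- x\<^sup>2 / 2)))"
    unfolding h by (intro ext DERIV_imp_deriv) (auto intro!: derivative_eq_intros simp: algebra_simps)
  have d2: "deriv (deriv (hermite_fun k)) x =
      c * ((poly (pderiv (pderiv p)) x - 2 * x * poly (pderiv p) x - poly p x + x\<^sup>2 * poly p x) * exp (- x\<^sup>2 / 2))"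
    unfolding d1 by (intro DERIV_imp_deriv)
      (auto intro!: derivative_eq_intros simp: algebra_simps power2_eq_square)
  have "pderiv ([:0, 2:] * p - pderiv p) = smult (2 * of_nat (Suc k)) p"
    using pderiv_hermite_poly[of k] by (simp add: p_def)
  then have "poly (pderiv ([:0, 2:] * p - pderiv p)) x = poly (smult (2 * of_nat (Suc k)) p) x"
    by simp
  then have ode: "poly (pderiv (pderiv p)) x = 2 * x * poly (pderiv p) x - 2 * real k * poly p x"
    by (simp add: pderiv_diff pderiv_mult pderiv_pCons pderiv_smult algebra_simps)
  show ?thesis unfolding d2 unfolding ode h by (simp add: algebra_simps)
qed

definition L2 :: "(real \<Rightarrow> complex) set" where
  "L2 = {f \<in> borel_measurable lebesgue. integrable lebesgue (\<lambda>x. (cmod (f x))\<^sup>2)}"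

definition hermite_coeff :: "(real \<Rightarrow> complex) \<Rightarrow> nat \<Rightarrow> complex" where
  "hermite_coeff f k = (LINT x|lebesgue. f x * of_real (hermite_fun k x))"

text \<open>\<open>hermite_sums c f\<close>: the series \<open>\<Sum>k. c k * h k\<close> converges to \<open>f\<close> in the \<open>L2\<close> norm. This
  determines \<open>f\<close> only up to null sets.\<close>

definition hermite_sums :: "(nat \<Rightarrow> complex) \<Rightarrow> (real \<Rightarrow> complex) \<Rightarrow> bool" where
  "hermite_sums c f \<longleftrightarrow> f \<in> L2 \<and>
     (\<lambda>n. LINT x|lebesgue. (cmod (f x - (\<Sum>k<n. c k * of_real (hermite_fun k x))))\<^sup>2) \<longlonglongrightarrow> 0"

text \<open>The space \<open>H\<^sup>-\<^sup>a\<^sup>/\<^sup>2 (L2)\<close>, where \<open>H\<close> acts on the \<open>k\<close>-th Hermite function as \<open>2 k + 1\<close>.\<close>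

definition hermite_sobolev :: "real \<Rightarrow> (real \<Rightarrow> complex) set" where
  "hermite_sobolev a =
     {f. \<exists>g\<in>L2. hermite_sums (\<lambda>k. of_real ((2 * real k + 1) powr (- a / 2)) * hermite_coeff g k) f}"

definition propagator_coeff :: "real \<Rightarrow> (real \<Rightarrow> complex) \<Rightarrow> nat \<Rightarrow> complex" where
  "propagator_coeff t f k = hermite_coeff f k * cis (t * (2 * real k + 1))"

text \<open>As an element of \<open>L2\<close>, the function \<open>e\<^sup>i\<^sup>t\<^sup>H f\<close> has no value at a given point, and a limit as
  \<open>t\<close> tends to \<open>0\<close> through uncountably many values depends on the representatives chosen.
  The representative used is the pointwise sum of the Hermite series. It is meaningful where that
  series converges.\<close>

definition propagator :: "real \<Rightarrow> (real \<Rightarrow> complex) \<Rightarrow> real \<Rightarrow> complex" where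
  "propagator t f x = (\<Sum>k. propagator_coeff t f k * of_real (hermite_fun k x))"

end

theory Submission
  imports Defs "HOL-Probability.Distributions"
begin

text \<open>
  The Hermite series of \<open>f\<close> converges absolutely at every point. The energy
  \<open>h\<^sub>k'\<^sup>2 + (2k + 1 - x\<^sup>2) h\<^sub>k\<^sup>2\<close> has derivative \<open>-2x h\<^sub>k\<^sup>2\<close>, so it is largest at
  \<open>0\<close>, where it is \<open>O(k\<^sup>1\<^sup>/\<^sup>2)\<close>; hence \<open>h\<^sub>k(x)\<^sup>2 = O(k\<^sup>-\<^sup>1\<^sup>/\<^sup>2)\<close> for
  fixed \<open>x\<close>, and \<open>\<Sum>k. (2k + 1)\<^sup>-\<^sup>a h\<^sub>k(x)\<^sup>2\<close> is finite when \<open>a > 1/2\<close>. With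
  \<open>\<Sum>k. (2k + 1)\<^sup>a \<bar>a\<^sub>k\<bar>\<^sup>2\<close> finite, \<open>\<Sum>k. \<bar>a\<^sub>k h\<^sub>k(x)\<bar>\<close> converges and dominates the series of
  the propagator uniformly in \<open>t\<close>, which is therefore continuous in \<open>t\<close>. At \<open>t = 0\<close> the
  pointwise sum agrees almost everywhere with the \<open>L2\<close> sum \<open>f\<close>.
\<close>

section \<open>Gaussian moments and orthogonality of the Hermite polynomials\<close>

lemma gaussian_moment:
  "has_bochner_integral lborel (\<lambda>x::real. x ^ n * exp (- x\<^sup>2))
     (if even n then sqrt pi * (fact n / (2 ^ n * fact (n div 2))) else 0)"
proof (cases "even n")
  case True
  then obtain k where n: "n = 2 * k" by blast
  show ?thesis
    using has_bochner_integral_even_function[OF gaussian_moment_even_pos[where k = k]]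
    by (simp add: n mult.commute)
next
  case False
  then obtain k where n: "n = 2 * k + 1" by (blast elim: oddE)
  have "has_bochner_integral lborel (\<lambda>x::real. exp (- x\<^sup>2) * x ^ (2 * k + 1)) 0"
    using gaussian_moment_odd_pos by (rule has_bochner_integral_odd_function) simp
  then show ?thesis by (simp add: n mult.commute)
qed

text \<open>Taking the polynomial alone as argument makes this a linear functional on
  \<open>real poly\<close>, so that orthogonality becomes polynomial algebra.\<close>

definition gauss_integral :: "real poly \<Rightarrow> real" where
  "gauss_integral p = (LINT x|lborel. poly p x * exp (- x\<^sup>2))"

lemma integrable_poly_gauss: "integrable lborel (\<lambda>x::real. poly p x * exp (- x\<^sup>2))"
proof -
  have "integrable lborel (\<lambda>x::real. \<Sum>i\<le>degree p. coeff p i * (x ^ i * exp (- x\<^sup>2)))"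
    by (intro Bochner_Integration.integrable_sum integrable_mult_right
      integrable.intros[OF gaussian_moment])
  then show ?thesis by (simp add: poly_altdef sum_distrib_right mult.assoc)
qed

lemma gauss_integral_add: "gauss_integral (p + q) = gauss_integral p + gauss_integral q"
  unfolding gauss_integral_def
  by (simp add: distrib_right Bochner_Integration.integral_add integrable_poly_gauss)

lemma gauss_integral_diff: "gauss_integral (p - q) = gauss_integral p - gauss_integral q"
  unfolding gauss_integral_def
  by (simp add: left_diff_distrib Bochner_Integration.integral_diff integrable_poly_gauss)

lemma gauss_integral_smult: "gauss_integral (smult c p) = c * gauss_integral p"
  unfolding gauss_integral_def by (simp add: mult.assoc)

lemma gauss_integral_monom:
  "gauss_integral (monom c n) =
     c * (if even n then sqrt pi * (fact n / (2 ^ n * fact (n div 2))) else 0)"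
  unfolding gauss_integral_def poly_monom mult.assoc
  by (simp only: integral_mult_right_zero has_bochner_integral_integral_eq[OF gaussian_moment])

text \<open>This is integration by parts against \<open>exp (- x\<^sup>2)\<close>, whose derivative
  brings down the factor \<open>- 2 * x\<close>. It is checked on monomials through the explicit
  moments and extended by linearity, so no boundary terms have to be estimated.\<close>

lemma gauss_integral_by_parts: "gauss_integral ([:0, 2:] * p) = gauss_integral (pderiv p)"
proof -
  have monom: "gauss_integral ([:0, 2:] * monom c n) = gauss_integral (pderiv (monom c n))" for c n
  proof -
    have shift: "[:0, 2:] * monom c n = monom (2 * c) (Suc n)"
      by (simp add: monom_Suc smult_monom)
    consider "n = 0" | "even n" "n > 0" | k where "n = 2 * k + 1" by (metis oddE gr0I)
    then show ?thesis
    proof cases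
      case 1
      then show ?thesis
        unfolding shift gauss_integral_monom pderiv_monom by simp
    next
      case 2
      then show ?thesis
        unfolding shift gauss_integral_monom pderiv_monom by simp
    next
      case (3 k)
      \<comment> \<open>For odd \<open>n\<close> the moments of orders \<open>n + 1\<close> and
        \<open>n - 1\<close> have ratio \<open>n / 2\<close>. For even \<open>n\<close> both sides
        vanish by parity.\<close>
      have "2 * (fact (Suc n) / (2 ^ Suc n * fact (Suc n div 2))) =
          (real n * (fact (n - 1) / (2 ^ (n - 1) * fact ((n - 1) div 2))))"
        by (simp add: 3 divide_simps)
      then have "2 * c * (sqrt pi * (fact (Suc n) / (2 ^ Suc n * fact (Suc n div 2)))) =
          real n * c * (sqrt pi * (fact (n - 1) / (2 ^ (n - 1) * fact ((n - 1) div 2))))"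
        by algebra
      moreover have "even (Suc n)" "even (n - 1)" by (simp_all add: 3)
      ultimately show ?thesis
        unfolding shift gauss_integral_monom pderiv_monom by (simp only: if_True)
    qed
  qed
  have "gauss_integral ([:0, 2:] * (\<Sum>i\<le>n. monom (coeff p i) i)) =
      gauss_integral (pderiv (\<Sum>i\<le>n. monom (coeff p i) i))" for n
  proof (induction n)
    case (Suc n)
    then show ?case
      by (simp only: sum.atMost_Suc distrib_left pderiv_add gauss_integral_add monom)
  next
    case 0
    have "(\<Sum>i\<le>0. monom (coeff p i) i) = monom (coeff p 0) 0" by simp
    then show ?case by (simp only: monom)
  qed
  from this[of "degree p"] show ?thesis by (simp only: poly_as_sum_of_monoms)
qed

text \<open>With respect to the Gaussian weight, the raising operator
  \<open>p \<mapsto> [:0, 2:] * p - pderiv p\<close> is the adjoint of \<open>pderiv\<close>. The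
  product rule exhibits the difference of the two sides as \<open>[:0, 2:] * r - pderiv r\<close>
  with \<open>r = hermite_poly k * q\<close>, which integrates to zero.\<close>

lemma gauss_integral_hermite_poly_Suc:
  "gauss_integral (hermite_poly (Suc k) * q) = gauss_integral (hermite_poly k * pderiv q)"
proof -
  have "hermite_poly (Suc k) * q =
      [:0, 2:] * (hermite_poly k * q) - pderiv (hermite_poly k * q) + hermite_poly k * pderiv q"
    by (simp only: hermite_poly.simps pderiv_mult) (simp only: algebra_simps)
  then show ?thesis
    by (simp only: gauss_integral_add gauss_integral_diff gauss_integral_by_parts)
qed

text \<open>Each use of adjointness lowers both degrees by one and contributes a factor
  \<open>2 * k\<close> from \<open>pderiv_hermite_poly\<close>. These factors build up
  \<open>2 ^ k * fact k\<close> when the degrees agree; otherwise a constant gets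
  differentiated.\<close>

lemma gauss_integral_hermite_poly:
  "gauss_integral (hermite_poly j * hermite_poly k) = (if j = k then 2 ^ k * fact k * sqrt pi else 0)"
proof (induction j arbitrary: k)
  case 0
  show ?case
  proof (cases k)
    case 0
    then show ?thesis using gauss_integral_monom[of 1 0] by (simp add: monom_0 one_pCons)
  next
    case (Suc l)
    have "gauss_integral (hermite_poly (Suc l) * 1) = 0"
      unfolding gauss_integral_hermite_poly_Suc by (simp add: gauss_integral_def pderiv_1)
    then show ?thesis by (simp add: Suc del: hermite_poly.simps(2))
  qed
next
  case (Suc j)
  show ?case
  proof (cases k)
    case 0
    then show ?thesis
      unfolding gauss_integral_hermite_poly_Suc by (simp add: gauss_integral_def pderiv_1)
  next
    case (Suc l)
    show ?thesis
      unfolding Suc gauss_integral_hermite_poly_Suc pderiv_hermite_poly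
      by (simp add: gauss_integral_smult Suc.IH del: hermite_poly.simps)
  qed
qed

section \<open>Orthonormality of the Hermite functions\<close>

lemma hermite_fun_mult:
  "hermite_fun j x * hermite_fun k x =
     (-1) ^ (j + k) / (sqrt (2 ^ j * fact j * sqrt pi) * sqrt (2 ^ k * fact k * sqrt pi)) *
       (poly (hermite_poly j * hermite_poly k) x * exp (- x\<^sup>2))"
proof -
  have "exp (- x\<^sup>2) = exp (- x\<^sup>2 / 2) * exp (- x\<^sup>2 / 2)" by (simp flip: exp_add)
  then show ?thesis by (simp add: hermite_fun_def power_add)
qed

lemma borel_measurable_hermite_fun [measurable]: "hermite_fun k \<in> borel_measurable borel"
proof -
  have [measurable]: "poly p \<in> borel_measurable borel" for p :: "real poly"
    by (intro borel_measurable_continuous_onI continuous_intros)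
  show ?thesis unfolding hermite_fun_def[abs_def] by measurable
qed

lemma measurable_hermite_fun_lebesgue [measurable]: "hermite_fun k \<in> borel_measurable lebesgue"
  by (rule measurable_completion) simp

lemma hermite_fun_orthonormal:
  "has_bochner_integral lebesgue (\<lambda>x. hermite_fun j x * hermite_fun k x) (if j = k then 1 else 0)"
proof -
  \<comment> \<open>The integral is computed over \<open>lborel\<close>, where the moments are
    available. Borel measurability of the integrand then carries it over to the completion
    \<open>lebesgue\<close>.\<close>
  have meas: "(\<lambda>x. hermite_fun j x * hermite_fun k x) \<in> borel_measurable lborel" by measurable
  have int: "integrable lborel (\<lambda>x. hermite_fun j x * hermite_fun k x)"
    unfolding hermite_fun_mult by (intro integrable_mult_right integrable_poly_gauss)
  have "(LINT x|lborel. hermite_fun j x * hermite_fun k x) = (if j = k then 1 else 0)"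
    unfolding hermite_fun_mult integral_mult_right_zero
    by (simp only: flip: gauss_integral_def) (simp add: gauss_integral_hermite_poly)
  then show ?thesis
    using int by (simp add: has_bochner_integral_iff integrable_completion[OF meas] integral_completion[OF meas])
qed

section \<open>Pointwise bounds for the Hermite functions\<close>

lemma poly_hermite_poly_0_Suc: "poly (hermite_poly (Suc k)) 0 = - poly (pderiv (hermite_poly k)) 0"
  by simp

text \<open>Two steps of the recursion multiply the normalised square of the value at
  \<open>0\<close> by \<open>(m + 1) / (m + 2)\<close>. The left side is chosen so that it does not
  increase under such a double step, because \<open>(m + 1) * (m + 3) \<le> (m + 2)\<^sup>2\<close>.
  The odd values vanish, starting from \<open>k = 1\<close>.\<close>

lemma poly_hermite_poly_0_bound:
  "((poly (hermite_poly k) 0)\<^sup>2 / (2 ^ k * fact k))\<^sup>2 * (real k + 1) \<le> 1"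
proof (induction k rule: less_induct)
  case (less k)
  consider "k = 0" | "k = 1" | m where "k = Suc (Suc m)"
    by (metis One_nat_def not0_implies_Suc)
  then show ?case
  proof cases
    case (3 m)
    define u where "u = (poly (hermite_poly m) 0)\<^sup>2 / (2 ^ m * fact m)"
    have "poly (hermite_poly k) 0 = - (2 * (real m + 1) * poly (hermite_poly m) 0)"
      unfolding 3 poly_hermite_poly_0_Suc pderiv_hermite_poly by (simp del: hermite_poly.simps)
    then have "(poly (hermite_poly k) 0)\<^sup>2 / (2 ^ k * fact k) = (real m + 1) / (real m + 2) * u"
      by (simp add: 3 u_def power2_eq_square divide_simps) (simp add: algebra_simps)
    then have "((poly (hermite_poly k) 0)\<^sup>2 / (2 ^ k * fact k))\<^sup>2 * (real k + 1) =
        (u\<^sup>2 * (real m + 1)) * ((real m + 1) * (real m + 3) / (real m + 2)\<^sup>2)"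
      by (simp add: 3 power_mult_distrib power_divide power2_eq_square)
    also have "\<dots> \<le> 1 * 1"
    proof (rule mult_mono)
      show "u\<^sup>2 * (real m + 1) \<le> 1"
        using less.IH[of m] by (simp add: 3 u_def)
      show "(real m + 1) * (real m + 3) / (real m + 2)\<^sup>2 \<le> 1"
        by (subst divide_le_eq_1_pos) (simp, simp add: power2_eq_square algebra_simps)
    qed auto
    finally show ?thesis by simp
  qed auto
qed

lemma poly_hermite_poly_0_le:
  "(poly (hermite_poly k) 0)\<^sup>2 / (2 ^ k * fact k) \<le> 1 / sqrt (real k + 1)"
proof -
  have "((poly (hermite_poly k) 0)\<^sup>2 / (2 ^ k * fact k))\<^sup>2 \<le> (1 / sqrt (real k + 1))\<^sup>2"
    using poly_hermite_poly_0_bound[of k] by (simp add: power_divide field_simps)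
  then show ?thesis by (rule power2_le_imp_le) simp
qed

text \<open>An equation between values of \<open>deriv\<close>, such as
  \<open>hermite_fun_eigenfunction\<close>, does not by itself give differentiability. The explicit
  derivatives supply it, and the eigenvalue equation then puts the second one into the form that the
  energy argument uses.\<close>

lemma has_derivative_hermite_fun:
  "(hermite_fun k has_real_derivative deriv (hermite_fun k) x) (at x)"
  "(deriv (hermite_fun k) has_real_derivative (x\<^sup>2 - (2 * real k + 1)) * hermite_fun k x) (at x)"
  "deriv (hermite_fun k) 0 =
     (-1) ^ k * poly (pderiv (hermite_poly k)) 0 / sqrt (2 ^ k * fact k * sqrt pi)"
proof -
  define p where "p = hermite_poly k"
  define c where "c = (-1) ^ k / sqrt (2 ^ k * fact k * sqrt pi)"
  have h: "hermite_fun k = (\<lambda>x. c * (poly p x * exp (- x\<^sup>2 / 2)))"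
    by (auto simp: hermite_fun_def c_def p_def)
  have D1: "(hermite_fun k has_real_derivative c * ((poly (pderiv p) x - x * poly p x) * exp (- x\<^sup>2 / 2))) (at x)" for x
    unfolding h by (auto intro!: derivative_eq_intros simp: algebra_simps)
  then have d1: "deriv (hermite_fun k) = (\<lambda>x. c * ((poly (pderiv p) x - x * poly p x) * exp (- x\<^sup>2 / 2)))"
    by (intro ext DERIV_imp_deriv)
  show "(hermite_fun k has_real_derivative deriv (hermite_fun k) x) (at x)"
    using D1 by (simp add: d1)
  have "(deriv (hermite_fun k) has_real_derivative
      c * ((poly (pderiv (pderiv p)) x - 2 * x * poly (pderiv p) x - poly p x + x\<^sup>2 * poly p x) *
        exp (- x\<^sup>2 / 2))) (at x)"
    unfolding d1 by (auto intro!: derivative_eq_intros simp: algebra_simps power2_eq_square)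
  then have "(deriv (hermite_fun k) has_real_derivative deriv (deriv (hermite_fun k)) x) (at x)"
    by (simp only: DERIV_imp_deriv)
  then show "(deriv (hermite_fun k) has_real_derivative (x\<^sup>2 - (2 * real k + 1)) * hermite_fun k x) (at x)"
    using hermite_fun_eigenfunction[of k x] by (simp add: algebra_simps)
  show "deriv (hermite_fun k) 0 =
      (-1) ^ k * poly (pderiv (hermite_poly k)) 0 / sqrt (2 ^ k * fact k * sqrt pi)"
    by (simp add: d1 c_def p_def)
qed

definition hermite_energy :: "nat \<Rightarrow> real \<Rightarrow> real" where
  "hermite_energy k x = (deriv (hermite_fun k) x)\<^sup>2 + (2 * real k + 1 - x\<^sup>2) * (hermite_fun k x)\<^sup>2"

text \<open>In the derivative of the energy the terms containing
  \<open>hermite_fun k x * deriv (hermite_fun k) x\<close> cancel by the eigenvalue equation. What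
  remains comes from differentiating the coefficient \<open>2 * real k + 1 - x\<^sup>2\<close>, and
  its sign is opposite to that of \<open>x\<close>.\<close>

lemma hermite_energy_le: "hermite_energy k x \<le> hermite_energy k 0"
proof -
  have D: "(hermite_energy k has_real_derivative - 2 * x * (hermite_fun k x)\<^sup>2) (at x)" for x
    unfolding hermite_energy_def[abs_def]
    by (rule derivative_eq_intros has_derivative_hermite_fun refl)+
      (simp add: algebra_simps power2_eq_square)
  show ?thesis
  proof (cases "0 \<le> x")
    case True
    then show ?thesis
      by (rule DERIV_nonpos_imp_nonincreasing) (auto intro!: exI D[THEN DERIV_cong] mult_nonneg_nonneg)
  next
    case False
    then have "x \<le> 0" by simp
    then show ?thesis
      by (rule DERIV_nonneg_imp_nondecreasing) (auto intro!: exI D[THEN DERIV_cong] mult_nonpos_nonneg)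
  qed
qed

text \<open>At \<open>0\<close> the derivative of \<open>hermite_fun k\<close> reduces to a multiple
  of \<open>poly (hermite_poly (k - 1)) 0\<close> for positive \<open>k\<close>. Thus
  \<open>poly_hermite_poly_0_le\<close> controls both terms of the energy, and each contributes at
  most \<open>2 * sqrt (2 * real k + 1)\<close>.\<close>

lemma hermite_energy_0_le: "hermite_energy k 0 \<le> 4 * sqrt (2 * real k + 1)"
proof -
  define u where "u j = (poly (hermite_poly j) 0)\<^sup>2 / (2 ^ j * fact j)" for j
  have u: "u j \<le> 1 / sqrt (real j + 1)" for j
    unfolding u_def by (rule poly_hermite_poly_0_le)
  have drop_pi: "y / sqrt pi \<le> y" if "0 \<le> y" for y :: real
    using mult_left_mono[of 1 "sqrt pi" y] that pi_ge_two by (simp add: field_simps)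
  have sqrt_cancel: "2 * y * (1 / sqrt y) = 2 * sqrt y" if "0 < y" for y :: real
    using that by (simp add: field_simps)
  have sq: "((-1) ^ k * y / sqrt (2 ^ k * fact k * sqrt pi))\<^sup>2 = y\<^sup>2 / (2 ^ k * fact k) / sqrt pi" for y :: real
    by (simp add: power_divide power_mult_distrib flip: power_mult)
  have "(hermite_fun k 0)\<^sup>2 = u k / sqrt pi"
    using sq[of "poly (hermite_poly k) 0"] by (simp add: hermite_fun_def u_def)
  also have "\<dots> \<le> u k" by (rule drop_pi) (simp add: u_def)
  also have "\<dots> \<le> 1 / sqrt (real k + 1)" by (rule u)
  finally have h: "(2 * real k + 1) * (hermite_fun k 0)\<^sup>2 \<le> (2 * real k + 1) * (1 / sqrt (real k + 1))"
    by (rule mult_left_mono) simp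
  also have "\<dots> \<le> 2 * (real k + 1) * (1 / sqrt (real k + 1))"
    by (intro mult_right_mono) auto
  also have "\<dots> = 2 * sqrt (real k + 1)"
    by (rule sqrt_cancel) simp
  also have "\<dots> \<le> 2 * sqrt (2 * real k + 1)" by simp
  finally have h: "(2 * real k + 1) * (hermite_fun k 0)\<^sup>2 \<le> 2 * sqrt (2 * real k + 1)" .
  have "(deriv (hermite_fun k) 0)\<^sup>2 \<le> 2 * sqrt (2 * real k + 1)"
  proof (cases k)
    case 0
    then show ?thesis by (simp add: has_derivative_hermite_fun pderiv_1)
  next
    case (Suc j)
    have "(deriv (hermite_fun k) 0)\<^sup>2 =
        (2 * (real j + 1) * poly (hermite_poly j) 0)\<^sup>2 / (2 ^ k * fact k) / sqrt pi"
      unfolding has_derivative_hermite_fun sq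
      by (simp only: Suc pderiv_hermite_poly poly_smult of_nat_Suc add.commute)
    also have "\<dots> = 2 * (real j + 1) * u j / sqrt pi"
    proof -
      \<comment> \<open>Here \<open>s = real j + 1\<close>, \<open>A = 2 ^ j\<close>,
        \<open>B = fact j\<close> and \<open>C = sqrt pi\<close>: one of the two factors
        \<open>2 * s\<close> in the square cancels against the growth of
        \<open>2 ^ k * fact k\<close>.\<close>
      have "(2 * s * y)\<^sup>2 / (2 * A * (s * B)) / C = 2 * s * (y\<^sup>2 / (A * B)) / C"
        if "s > 0" for s y A B C :: real
        using that by (simp add: power2_eq_square)
      from this[of "real j + 1"] show ?thesis by (simp add: u_def Suc add.commute)
    qed
    also have "\<dots> \<le> 2 * (real j + 1) * u j" by (rule drop_pi) (simp add: u_def)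
    also have "\<dots> \<le> 2 * (real j + 1) * (1 / sqrt (real j + 1))"
      by (intro mult_left_mono u) simp
    also have "\<dots> = 2 * sqrt (real j + 1)"
      by (rule sqrt_cancel) simp
    also have "\<dots> \<le> 2 * sqrt (2 * real k + 1)" by (simp add: Suc)
    finally show ?thesis .
  qed
  with h show ?thesis by (simp add: hermite_energy_def)
qed

text \<open>The assumption keeps \<open>x\<close> well inside the oscillatory region: there
  \<open>2 * real k + 1 - x\<^sup>2\<close> is at least half of \<open>2 * real k + 1\<close>, so
  the energy bound limits the function itself. The constant \<open>8\<close> is this factor
  \<open>2\<close> times the \<open>4\<close> of \<open>hermite_energy_0_le\<close>.\<close>

lemma hermite_fun_square_le:
  assumes "2 * x\<^sup>2 \<le> 2 * real k + 1"
  shows "(hermite_fun k x)\<^sup>2 \<le> 8 * (2 * real k + 1) powr (- 1 / 2)"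
proof -
  define N where "N = 2 * real k + 1"
  have N: "N > 0" by (simp add: N_def)
  have "N / 2 * (hermite_fun k x)\<^sup>2 \<le> (N - x\<^sup>2) * (hermite_fun k x)\<^sup>2"
    using assms by (intro mult_right_mono) (auto simp: N_def)
  also have "\<dots> \<le> hermite_energy k x" by (simp add: hermite_energy_def N_def)
  also have "\<dots> \<le> 4 * sqrt N"
    unfolding N_def using hermite_energy_le hermite_energy_0_le by (rule order_trans)
  finally have "(hermite_fun k x)\<^sup>2 \<le> 8 * (sqrt N / N)"
    using N by (simp add: field_simps)
  also have "sqrt N / N = N powr (- 1 / 2)"
    using N by (simp add: powr_minus powr_half_sqrt sqrt_divide_self_eq)
  finally show ?thesis by (simp add: N_def)
qed

lemma summable_hermite_fun_square:
  assumes "a > 1 / 2"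
  shows "summable (\<lambda>k. (2 * real k + 1) powr (- a) * (hermite_fun k x)\<^sup>2)"
proof (rule summable_comparison_test_ev)
  show "summable (\<lambda>k. 8 * real k powr (- a - 1 / 2))"
    using assms by (intro summable_mult) (simp add: summable_real_powr_iff)
  \<comment> \<open>For such \<open>k\<close> the bound \<open>hermite_fun_square_le\<close> applies
    at the fixed point \<open>x\<close>. The index \<open>0\<close> is excluded as well, since
    \<open>0 powr y\<close> is \<open>0\<close> and could not serve as a majorant.\<close>
  have "eventually (\<lambda>k. x\<^sup>2 \<le> real k) sequentially"
    using filterlim_real_sequentially by (simp add: filterlim_at_top)
  then show "eventually (\<lambda>k. norm ((2 * real k + 1) powr (- a) * (hermite_fun k x)\<^sup>2) \<le>
      8 * real k powr (- a - 1 / 2)) sequentially"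
    using eventually_gt_at_top[of 0]
  proof eventually_elim
    case (elim k)
    then have "(2 * real k + 1) powr (- a) * (hermite_fun k x)\<^sup>2 \<le>
        (2 * real k + 1) powr (- a) * (8 * (2 * real k + 1) powr (- 1 / 2))"
      by (intro mult_left_mono hermite_fun_square_le) auto
    also have "\<dots> = 8 * (2 * real k + 1) powr (- a - 1 / 2)"
      by (simp flip: powr_add)
    also have "\<dots> \<le> 8 * real k powr (- a - 1 / 2)"
      using elim assms by (intro mult_left_mono powr_mono2') auto
    finally show ?case by simp
  qed
qed

section \<open>Hermite expansions in \<open>L2\<close>\<close>

abbreviation hermite_partial :: "(nat \<Rightarrow> complex) \<Rightarrow> nat set \<Rightarrow> real \<Rightarrow> complex" where
  "hermite_partial c A x \<equiv> (\<Sum>k\<in>A. c k * of_real (hermite_fun k x))"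

lemma L2_measurable: "f \<in> L2 \<Longrightarrow> f \<in> borel_measurable lebesgue"
  by (simp add: L2_def)

lemma L2_integrable: "f \<in> L2 \<Longrightarrow> integrable lebesgue (\<lambda>x. (cmod (f x))\<^sup>2)"
  by (simp add: L2_def)

text \<open>This is the parallelogram law with one term dropped. It stands in for the triangle
  inequality of the \<open>L2\<close> norm while working only with integrals of squares.\<close>

lemma cmod_diff_square_le: "(cmod (z - w))\<^sup>2 \<le> 2 * (cmod z)\<^sup>2 + 2 * (cmod w)\<^sup>2"
proof -
  have "(cmod (z - w))\<^sup>2 + (cmod (z + w))\<^sup>2 = 2 * (cmod z)\<^sup>2 + 2 * (cmod w)\<^sup>2"
    by (simp only: cmod_power2) (simp add: power2_eq_square algebra_simps)
  moreover have "0 \<le> (cmod (z + w))\<^sup>2" by simp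
  ultimately show ?thesis by linarith
qed

lemma L2_diff:
  assumes "f \<in> L2" and "g \<in> L2"
  shows "(\<lambda>x. f x - g x) \<in> L2"
proof -
  note [measurable] = assms[THEN L2_measurable]
  have "integrable lebesgue (\<lambda>x. 2 * (cmod (f x))\<^sup>2 + 2 * (cmod (g x))\<^sup>2)"
    using assms by (intro Bochner_Integration.integrable_add integrable_mult_right L2_integrable)
  then have "integrable lebesgue (\<lambda>x. (cmod (f x - g x))\<^sup>2)"
    by (rule Bochner_Integration.integrable_bound) (auto simp: cmod_diff_square_le)
  then show ?thesis by (simp add: L2_def)
qed

text \<open>The product is dominated by the sum of the two squares. Hence
  \<open>hermite_coeff\<close> is a genuine integral on \<open>L2\<close>, not the default value
  \<open>0\<close> of a non-integrable function.\<close>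

lemma L2_mult_hermite_fun_integrable:
  assumes "f \<in> L2"
  shows "integrable lebesgue (\<lambda>x. f x * of_real (hermite_fun k x))"
proof -
  note [measurable] = L2_measurable[OF assms]
  have "integrable lebesgue (\<lambda>x. (cmod (f x))\<^sup>2 + hermite_fun k x * hermite_fun k x)"
    using assms integrable.intros[OF hermite_fun_orthonormal[of k k]]
    by (intro Bochner_Integration.integrable_add L2_integrable)
  then show ?thesis
  proof (rule Bochner_Integration.integrable_bound)
    have "cmod (f x) * \<bar>hermite_fun k x\<bar> \<le> (cmod (f x))\<^sup>2 + hermite_fun k x * hermite_fun k x" for x
    proof -
      have "0 \<le> cmod (f x) * \<bar>hermite_fun k x\<bar>" by simp
      moreover have "\<bar>hermite_fun k x\<bar>\<^sup>2 = hermite_fun k x * hermite_fun k x"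
        by (simp add: power2_eq_square)
      ultimately show ?thesis
        using sum_squares_bound[of "cmod (f x)" "\<bar>hermite_fun k x\<bar>"] by linarith
    qed
    then show "AE x in lebesgue. norm (f x * of_real (hermite_fun k x)) \<le>
        norm ((cmod (f x))\<^sup>2 + hermite_fun k x * hermite_fun k x)"
      by (simp add: norm_mult)
  qed measurable
qed

text \<open>Pythagoras for a finite orthonormal family: the squared modulus expands into a double
  sum, and integration keeps only its diagonal.\<close>

lemma hermite_partial_has_square_integral:
  assumes "finite A"
  shows "has_bochner_integral lebesgue (\<lambda>x. (cmod (hermite_partial c A x))\<^sup>2) (\<Sum>k\<in>A. (cmod (c k))\<^sup>2)"
proof -
  have "(cmod (hermite_partial c A x))\<^sup>2 =
      (\<Sum>j\<in>A. \<Sum>k\<in>A. Re (c j * cnj (c k)) * (hermite_fun j x * hermite_fun k x))" for x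
  proof -
    have "(cmod (hermite_partial c A x))\<^sup>2 = Re (hermite_partial c A x * cnj (hermite_partial c A x))"
      by (simp only: complex_mult_cnj cmod_power2 Re_complex_of_real)
    also have "\<dots> = (\<Sum>j\<in>A. \<Sum>k\<in>A. Re (c j * cnj (c k)) * (hermite_fun j x * hermite_fun k x))"
      unfolding cnj_sum sum_product Re_sum by (intro sum.cong refl) (simp add: algebra_simps)
    finally show ?thesis .
  qed
  moreover have "has_bochner_integral lebesgue
      (\<lambda>x. \<Sum>j\<in>A. \<Sum>k\<in>A. Re (c j * cnj (c k)) * (hermite_fun j x * hermite_fun k x))
      (\<Sum>j\<in>A. \<Sum>k\<in>A. Re (c j * cnj (c k)) * (if j = k then 1 else 0))"
    by (intro has_bochner_integral_sum has_bochner_integral_mult_right hermite_fun_orthonormal)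
  moreover have "(\<Sum>j\<in>A. \<Sum>k\<in>A. Re (c j * cnj (c k)) * (if j = k then 1 else 0)) = (\<Sum>k\<in>A. (cmod (c k))\<^sup>2)"
    using assms by (intro sum.cong refl)
      (simp add: if_distrib[of "times y" for y] sum.delta' cmod_power2 flip: power2_eq_square cong: if_cong)
  ultimately show ?thesis by simp
qed

lemma hermite_partial_in_L2:
  assumes "finite A"
  shows "hermite_partial c A \<in> L2"
proof -
  have "integrable lebesgue (\<lambda>x. (cmod (hermite_partial c A x))\<^sup>2)"
    using hermite_partial_has_square_integral[OF assms] by (rule integrable.intros)
  moreover have "hermite_partial c A \<in> borel_measurable lebesgue"
    by measurable
  ultimately show ?thesis by (simp add: L2_def)
qed

text \<open>Completing the square in each coefficient gives this best-approximation identity. Taking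
  \<open>c = hermite_coeff g\<close> yields Bessel's inequality; with general \<open>c\<close> the
  last sum measures how far \<open>c\<close> is from the true coefficients.\<close>

lemma integral_cmod_square_diff_hermite_partial:
  assumes "g \<in> L2" and "finite A"
  shows "(LINT x|lebesgue. (cmod (g x - hermite_partial c A x))\<^sup>2) =
    (LINT x|lebesgue. (cmod (g x))\<^sup>2) - (\<Sum>k\<in>A. (cmod (hermite_coeff g k))\<^sup>2)
      + (\<Sum>k\<in>A. (cmod (c k - hermite_coeff g k))\<^sup>2)"
proof -
  have sq: "(cmod (g x - hermite_partial c A x))\<^sup>2 = (cmod (g x))\<^sup>2
      - 2 * (\<Sum>k\<in>A. Re (cnj (c k) * (g x * of_real (hermite_fun k x)))) + (cmod (hermite_partial c A x))\<^sup>2" for x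
  proof -
    have "(cmod (z - w))\<^sup>2 = (cmod z)\<^sup>2 - 2 * Re (z * cnj w) + (cmod w)\<^sup>2" for z w
      by (simp only: cmod_power2) (simp add: power2_eq_square algebra_simps)
    moreover have "g x * cnj (hermite_partial c A x) = (\<Sum>k\<in>A. cnj (c k) * (g x * of_real (hermite_fun k x)))"
      by (simp add: sum_distrib_left mult_ac)
    ultimately show ?thesis by (simp only: Re_sum)
  qed
  have cross: "has_bochner_integral lebesgue (\<lambda>x. Re (cnj (c k) * (g x * of_real (hermite_fun k x))))
      (Re (cnj (c k) * hermite_coeff g k))" for k
    unfolding hermite_coeff_def
    by (intro has_bochner_integral_Re has_bochner_integral_mult_right
      has_bochner_integral_integrable L2_mult_hermite_fun_integrable assms)
  have "has_bochner_integral lebesgue (\<lambda>x. (cmod (g x - hermite_partial c A x))\<^sup>2)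
      ((LINT x|lebesgue. (cmod (g x))\<^sup>2) - 2 * (\<Sum>k\<in>A. Re (cnj (c k) * hermite_coeff g k))
        + (\<Sum>k\<in>A. (cmod (c k))\<^sup>2))"
    unfolding sq
    by (intro has_bochner_integral_add has_bochner_integral_diff has_bochner_integral_mult_right
      has_bochner_integral_sum cross hermite_partial_has_square_integral assms
      has_bochner_integral_integrable L2_integrable)
  moreover have "(cmod (c k - hermite_coeff g k))\<^sup>2 =
      (cmod (c k))\<^sup>2 - 2 * Re (cnj (c k) * hermite_coeff g k) + (cmod (hermite_coeff g k))\<^sup>2" for k
    by (simp only: cmod_power2) (simp add: power2_eq_square algebra_simps)
  ultimately show ?thesis
    by (simp add: has_bochner_integral_iff sum.distrib sum_subtractf sum_distrib_left)
qed

lemma bessel_inequality: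
  assumes "g \<in> L2" and "finite A"
  shows "(\<Sum>k\<in>A. (cmod (hermite_coeff g k))\<^sup>2) \<le> (LINT x|lebesgue. (cmod (g x))\<^sup>2)"
proof -
  have "0 \<le> (LINT x|lebesgue. (cmod (g x - hermite_partial (hermite_coeff g) A x))\<^sup>2)"
    by simp
  also have "\<dots> = (LINT x|lebesgue. (cmod (g x))\<^sup>2) - (\<Sum>k\<in>A. (cmod (hermite_coeff g k))\<^sup>2)"
    unfolding integral_cmod_square_diff_hermite_partial[OF assms] by simp
  finally show ?thesis by simp
qed

lemma summable_hermite_coeff_square:
  assumes "g \<in> L2"
  shows "summable (\<lambda>k. (cmod (hermite_coeff g k))\<^sup>2)"
proof (rule bounded_imp_summable)
  show "(\<Sum>k\<le>n. (cmod (hermite_coeff g k))\<^sup>2) \<le> (LINT x|lebesgue. (cmod (g x))\<^sup>2)" for n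
    by (rule bessel_inequality[OF assms]) simp
qed simp

text \<open>By the preceding identity and Bessel's inequality, the squared error of a partial sum of
  length \<open>n > k\<close> is at least the squared error in the \<open>k\<close>-th coefficient.
  The former tends to zero and the latter does not depend on \<open>n\<close>.\<close>

lemma hermite_sums_imp_coeff:
  assumes "hermite_sums c f"
  shows "hermite_coeff f = c"
proof
  fix k
  have f: "f \<in> L2" and lim: "(\<lambda>n. LINT x|lebesgue. (cmod (f x - hermite_partial c {..<n} x))\<^sup>2) \<longlonglongrightarrow> 0"
    using assms by (auto simp: hermite_sums_def)
  have "(cmod (c k - hermite_coeff f k))\<^sup>2 \<le> 0"
  proof (rule tendsto_lowerbound[OF lim])
    show "\<forall>\<^sub>F n in sequentially. (cmod (c k - hermite_coeff f k))\<^sup>2 \<le>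
        (LINT x|lebesgue. (cmod (f x - hermite_partial c {..<n} x))\<^sup>2)"
      using eventually_gt_at_top[of k]
    proof eventually_elim
      case (elim n)
      then have "(cmod (c k - hermite_coeff f k))\<^sup>2 \<le> (\<Sum>k<n. (cmod (c k - hermite_coeff f k))\<^sup>2)"
        by (intro member_le_sum) auto
      then show ?case
        using bessel_inequality[OF f, of "{..<n}"]
        by (simp add: integral_cmod_square_diff_hermite_partial[OF f])
    qed
  qed simp
  then show "hermite_coeff f k = c k" by simp
qed

text \<open>Both functions are compared with the same partial sums, so their squared distance is at
  most twice the sum of two errors that tend to zero.\<close>

lemma hermite_sums_unique:
  assumes "hermite_sums c f" and "hermite_sums c g"
  shows "AE x in lebesgue. f x = g x"
proof -
  have f: "f \<in> L2" and g: "g \<in> L2" using assms by (auto simp: hermite_sums_def)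
  define S where "S n = hermite_partial c {..<n}" for n
  have S: "S n \<in> L2" for n unfolding S_def by (rule hermite_partial_in_L2) simp
  have "(LINT x|lebesgue. (cmod (f x - g x))\<^sup>2) \<le> 2 * 0 + 2 * 0"
  proof (rule tendsto_lowerbound)
    show "(\<lambda>n. 2 * (LINT x|lebesgue. (cmod (f x - S n x))\<^sup>2) + 2 * (LINT x|lebesgue. (cmod (g x - S n x))\<^sup>2))
        \<longlonglongrightarrow> 2 * 0 + 2 * 0"
      using assms unfolding hermite_sums_def S_def by (intro tendsto_intros) auto
    have "(LINT x|lebesgue. (cmod (f x - g x))\<^sup>2) \<le>
        2 * (LINT x|lebesgue. (cmod (f x - S n x))\<^sup>2) + 2 * (LINT x|lebesgue. (cmod (g x - S n x))\<^sup>2)" for n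
    proof -
      have int: "integrable lebesgue (\<lambda>x. (cmod (f x - S n x))\<^sup>2)" "integrable lebesgue (\<lambda>x. (cmod (g x - S n x))\<^sup>2)"
        by (intro L2_integrable L2_diff f g S)+
      have "(LINT x|lebesgue. (cmod (f x - g x))\<^sup>2) \<le>
          (LINT x|lebesgue. 2 * (cmod (f x - S n x))\<^sup>2 + 2 * (cmod (g x - S n x))\<^sup>2)"
        using int cmod_diff_square_le[of "f x - S n x" "g x - S n x" for x]
        by (intro integral_mono L2_integrable[OF L2_diff[OF f g]]) auto
      also have "\<dots> = 2 * (LINT x|lebesgue. (cmod (f x - S n x))\<^sup>2) + 2 * (LINT x|lebesgue. (cmod (g x - S n x))\<^sup>2)"
        using int by simp
      finally show ?thesis .
    qed
    then show "\<forall>\<^sub>F n in sequentially. (LINT x|lebesgue. (cmod (f x - g x))\<^sup>2) \<le>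
        2 * (LINT x|lebesgue. (cmod (f x - S n x))\<^sup>2) + 2 * (LINT x|lebesgue. (cmod (g x - S n x))\<^sup>2)"
      by simp
  qed simp
  then have "(LINT x|lebesgue. (cmod (f x - g x))\<^sup>2) = 0"
    by (simp add: antisym)
  then have "AE x in lebesgue. (cmod (f x - g x))\<^sup>2 = 0"
    by (subst (asm) integral_nonneg_eq_0_iff_AE[OF L2_integrable[OF L2_diff[OF f g]]]) auto
  then show ?thesis by simp
qed

text \<open>Fatou's lemma along the partial sums bounds the square integral of the tail.\<close>

lemma hermite_sums_pointwise:
  assumes c: "summable (\<lambda>k. (cmod (c k))\<^sup>2)"
    and pointwise: "\<And>x. (\<lambda>k. c k * of_real (hermite_fun k x)) sums F x"
  shows "hermite_sums c F"
proof -
  define S where "S n = hermite_partial c {..<n}" for n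
  define tail where "tail n = (\<Sum>k. (cmod (c (k + n)))\<^sup>2)" for n
  have lim: "(\<lambda>n. S n x) \<longlonglongrightarrow> F x" for x
    using pointwise[of x] unfolding sums_def S_def .
  have S: "S n \<in> L2" for n unfolding S_def by (rule hermite_partial_in_L2) simp
  note [measurable] = S[THEN L2_measurable]
  have F [measurable]: "F \<in> borel_measurable lebesgue"
    by (rule borel_measurable_LIMSEQ_metric[OF L2_measurable[OF S] lim])
  have c_shift: "summable (\<lambda>k. (cmod (c (k + n)))\<^sup>2)" for n
    using summable_ignore_initial_segment[OF c] .
  have tail_nonneg: "0 \<le> tail n" for n
    unfolding tail_def by (rule suminf_nonneg[OF c_shift]) simp
  \<comment> \<open>The estimate is made with nonnegative integrals because integrability of the
    limit \<open>F x - S n x\<close> is not known beforehand; it is a consequence of the resulting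
    bound.\<close>
  have Cauchy: "(\<integral>\<^sup>+x. ennreal ((cmod (S m x - S n x))\<^sup>2) \<partial>lebesgue) \<le> ennreal (tail n)" if "n \<le> m" for n m
  proof -
    have "S m x - S n x = hermite_partial c {n..<m} x" for x
      using sum_diff_nat_ivl[of 0 n m "\<lambda>k. c k * of_real (hermite_fun k x)"] that
      by (simp add: S_def lessThan_atLeast0)
    then have "(\<integral>\<^sup>+x. ennreal ((cmod (S m x - S n x))\<^sup>2) \<partial>lebesgue) =
        ennreal (\<Sum>k\<in>{n..<m}. (cmod (c k))\<^sup>2)"
      using hermite_partial_has_square_integral[of "{n..<m}" c]
      by (simp add: nn_integral_eq_integral has_bochner_integral_iff)
    also have "(\<Sum>k\<in>{n..<m}. (cmod (c k))\<^sup>2) = (\<Sum>k<m - n. (cmod (c (k + n)))\<^sup>2)"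
      using that sum.shift_bounds_nat_ivl[of "\<lambda>k. (cmod (c k))\<^sup>2" 0 n "m - n"] by (simp add: atLeast0LessThan)
    also have "ennreal \<dots> \<le> ennreal (tail n)"
      unfolding tail_def
      by (intro ennreal_leI sum_le_suminf[OF c_shift]) auto
    finally show ?thesis .
  qed
  have bound: "(\<integral>\<^sup>+x. ennreal ((cmod (F x - S n x))\<^sup>2) \<partial>lebesgue) \<le> ennreal (tail n)" for n
  proof -
    have "(\<lambda>m. ennreal ((cmod (S m x - S n x))\<^sup>2)) \<longlonglongrightarrow> ennreal ((cmod (F x - S n x))\<^sup>2)" for x
      by (intro tendsto_intros lim)
    then have "liminf (\<lambda>m. ennreal ((cmod (S m x - S n x))\<^sup>2)) = ennreal ((cmod (F x - S n x))\<^sup>2)" for x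
      by (intro lim_imp_Liminf) auto
    then have "(\<integral>\<^sup>+x. ennreal ((cmod (F x - S n x))\<^sup>2) \<partial>lebesgue) =
        (\<integral>\<^sup>+x. liminf (\<lambda>m. ennreal ((cmod (S m x - S n x))\<^sup>2)) \<partial>lebesgue)"
      by simp
    also have "\<dots> \<le> liminf (\<lambda>m. \<integral>\<^sup>+x. ennreal ((cmod (S m x - S n x))\<^sup>2) \<partial>lebesgue)"
      by (rule nn_integral_liminf) measurable
    also have "\<dots> \<le> ennreal (tail n)"
    proof (rule Liminf_le)
      show "\<forall>\<^sub>F m in sequentially.
          (\<integral>\<^sup>+x. ennreal ((cmod (S m x - S n x))\<^sup>2) \<partial>lebesgue) \<le> ennreal (tail n)"
        using eventually_ge_at_top[of n] by eventually_elim (rule Cauchy)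
    qed simp
    finally show ?thesis .
  qed
  have diff: "(\<lambda>x. F x - S n x) \<in> L2" for n
  proof -
    have "integrable lebesgue (\<lambda>x. (cmod (F x - S n x))\<^sup>2)"
    proof (rule integrableI_nonneg)
      show "(\<integral>\<^sup>+x. ennreal ((cmod (F x - S n x))\<^sup>2) \<partial>lebesgue) < \<infinity>"
        using bound[of n] by (rule order.strict_trans1) simp
    qed auto
    then show ?thesis by (simp add: L2_def)
  qed
  \<comment> \<open>\<open>S 0\<close> is the empty sum, so the case \<open>n = 0\<close> concerns
    \<open>F\<close> itself.\<close>
  have "F \<in> L2" using diff[of 0] by (simp add: S_def)
  moreover have "(\<lambda>n. LINT x|lebesgue. (cmod (F x - S n x))\<^sup>2) \<longlonglongrightarrow> 0"
  proof (rule tendsto_sandwich[OF _ _ tendsto_const])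
    show "tail \<longlonglongrightarrow> 0"
      unfolding tail_def using suminf_exist_split2[OF c] .
    have "(LINT x|lebesgue. (cmod (F x - S n x))\<^sup>2) \<le> tail n" for n
      using bound[of n] tail_nonneg[of n]
      by (simp add: nn_integral_eq_integral[OF L2_integrable[OF diff]])
    then show "\<forall>\<^sub>F n in sequentially. (LINT x|lebesgue. (cmod (F x - S n x))\<^sup>2) \<le> tail n"
      by simp
  qed simp
  ultimately show ?thesis by (simp add: hermite_sums_def S_def)
qed

section \<open>Pointwise convergence of the propagator\<close>

theorem theorem10:
  fixes a :: real and f :: "real \<Rightarrow> complex"
  assumes "a > 1 / 2" and "f \<in> hermite_sobolev a"
  shows "(\<forall>t. hermite_sums (propagator_coeff t f) (propagator t f)) \<and>
    (AE x in lebesgue.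
       (\<forall>t. summable (\<lambda>k. propagator_coeff t f k * of_real (hermite_fun k x))) \<and>
       ((\<lambda>t. propagator t f x) \<longlongrightarrow> f x) (at 0))"
proof -
  obtain g where g: "g \<in> L2"
    and f: "hermite_sums (\<lambda>k. of_real ((2 * real k + 1) powr (- a / 2)) * hermite_coeff g k) f"
    using assms(2) by (auto simp: hermite_sobolev_def)
  have coeff: "hermite_coeff f k = of_real ((2 * real k + 1) powr (- a / 2)) * hermite_coeff g k" for k
    using hermite_sums_imp_coeff[OF f] by (rule fun_cong)
  have sums_f: "hermite_sums (hermite_coeff f) f"
    by (subst hermite_sums_imp_coeff[OF f]) (rule f)
  have f_L2: "f \<in> L2" using f by (simp add: hermite_sums_def)
  \<comment> \<open>Since \<open>cis\<close> has modulus one, the terms of the propagator series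
    have norm \<open>M x k\<close> for every \<open>t\<close>. This makes one majorant available for
    all times.\<close>
  define M where "M x k = cmod (hermite_coeff f k) * \<bar>hermite_fun k x\<bar>" for x k
  have norm_term: "norm (propagator_coeff t f k * of_real (hermite_fun k x)) = M x k" for t x k
    by (simp add: M_def propagator_coeff_def norm_mult)
  have M: "summable (M x)" for x
  proof (rule summable_comparison_test)
    \<comment> \<open>The weight \<open>(2 * real k + 1) powr (- a / 2)\<close> is moved from the
      coefficient of \<open>f\<close> to the Hermite function. The product of the two resulting
      factors is then at most the sum of their squares.\<close>
    show "summable (\<lambda>k. (cmod (hermite_coeff g k))\<^sup>2 + (2 * real k + 1) powr (- a) * (hermite_fun k x)\<^sup>2)"
      by (intro summable_add summable_hermite_coeff_square summable_hermite_fun_square g assms(1))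
    have "M x k \<le> (cmod (hermite_coeff g k))\<^sup>2 + (2 * real k + 1) powr (- a) * (hermite_fun k x)\<^sup>2" for k
    proof -
      define w where "w = (2 * real k + 1) powr (- a / 2) * \<bar>hermite_fun k x\<bar>"
      have "M x k = cmod (hermite_coeff g k) * w"
        by (simp add: M_def coeff w_def norm_mult)
      also have "\<dots> \<le> (cmod (hermite_coeff g k))\<^sup>2 + w\<^sup>2"
      proof -
        have "0 \<le> cmod (hermite_coeff g k) * w" by (simp add: w_def)
        then show ?thesis
          using sum_squares_bound[of "cmod (hermite_coeff g k)" w] by linarith
      qed
      also have "w\<^sup>2 = (2 * real k + 1) powr (- a) * (hermite_fun k x)\<^sup>2"
      proof -
        have "((2 * real k + 1) powr (- a / 2))\<^sup>2 = (2 * real k + 1) powr (- a)"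
          unfolding power2_eq_square powr_add[symmetric] by simp
        then show ?thesis by (simp only: w_def power_mult_distrib power2_abs)
      qed
      finally show ?thesis .
    qed
    then show "\<exists>N. \<forall>k\<ge>N. norm (M x k) \<le>
        (cmod (hermite_coeff g k))\<^sup>2 + (2 * real k + 1) powr (- a) * (hermite_fun k x)\<^sup>2"
      by (auto simp: M_def)
  qed
  have summable: "summable (\<lambda>k. propagator_coeff t f k * of_real (hermite_fun k x))" for t x
    by (rule summable_norm_cancel) (simp only: norm_term M)
  have sums: "hermite_sums (propagator_coeff t f) (propagator t f)" for t
  proof (rule hermite_sums_pointwise)
    show "summable (\<lambda>k. (cmod (propagator_coeff t f k))\<^sup>2)"
      using summable_hermite_coeff_square[OF f_L2] by (simp add: propagator_coeff_def norm_mult)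
    show "(\<lambda>k. propagator_coeff t f k * of_real (hermite_fun k x)) sums propagator t f x" for x
      unfolding propagator_def using summable by (rule summable_sums)
  qed
  have cont: "((\<lambda>t. propagator t f x) \<longlongrightarrow> propagator 0 f x) (at 0)" for x
  proof -
    have "continuous_on UNIV (\<lambda>t. propagator t f x)"
    proof (rule uniform_limit_theorem)
      show "uniform_limit UNIV (\<lambda>n t. \<Sum>k<n. propagator_coeff t f k * of_real (hermite_fun k x))
          (\<lambda>t. propagator t f x) sequentially"
        unfolding propagator_def by (rule Weierstrass_m_test[OF _ M[of x]]) (simp add: norm_term)
      show "\<forall>\<^sub>F n in sequentially.
          continuous_on UNIV (\<lambda>t. \<Sum>k<n. propagator_coeff t f k * of_real (hermite_fun k x))"
        unfolding propagator_coeff_def by (intro always_eventually allI continuous_intros)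
    qed simp
    then show ?thesis by (simp add: continuous_on_eq_continuous_at isCont_def)
  qed
  \<comment> \<open>At \<open>t = 0\<close> the phases equal \<open>1\<close>, so
    \<open>propagator 0 f\<close> and \<open>f\<close> are \<open>L2\<close> sums of the same
    series. Summability and continuity in \<open>t\<close> hold at every \<open>x\<close>, so the
    exceptional null set arises only from this comparison and does not depend on
    \<open>t\<close>.\<close>
  have "hermite_sums (hermite_coeff f) (propagator 0 f)"
    using sums[of 0] by (simp add: propagator_coeff_def[abs_def])
  then have "AE x in lebesgue. propagator 0 f x = f x"
    using sums_f by (rule hermite_sums_unique)
  then have "AE x in lebesgue. (\<forall>t. summable (\<lambda>k. propagator_coeff t f k * of_real (hermite_fun k x))) \<and>
      ((\<lambda>t. propagator t f x) \<longlongrightarrow> f x) (at 0)"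
  proof eventually_elim
    case (elim x)
    with cont[of x] summable show ?case by simp
  qed
  with sums show ?thesis by blast
qed

end
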